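(* Let $\mathcal{L}$ be a lattice with least element $\bot$ whose height function is $p$-incremental, i.e. $h(X\vee a)-h(X)\le p$ for all $X\in\mathcal{L}$ and all $a\in\mathrm{adm}(X)$. Let $k$ be a positive integer and $\mathcal{F}=\{X\in\mathcal{L}: h(X)\le k\}$. Let $f\colon\mathcal{L}\to\mathbb{R}$ be a monotone function with $f(\bot)=0$ that is downward DR-submodular with additive gap $\delta$. Consider the greedy algorithm: set $X=\bot$; for $i=1,\dots,k$, choose $a_i\in\operatorname{argmax}_{a\in\mathrm{adm}(X),\,X\vee a\in\mathcal{F}} f(X\vee a)$ and set $X\leftarrow X\vee a_i$; return $X$ (each argmax is assumed to be attained). Then the returned $X$ is a $\bigl(1-e^{-\lfloor k/p\rfloor/k},\ \delta(1-e^{-\lfloor k/p\rfloor/k})k\bigr)$-approximate solution of the problem $\max\{f(X): X\in\mathcal{F}\}$, i.e. $$f(X)\ \ge\ \bigl(1-e^{-\lfloor k/p\rfloor/k}\bigr)\max_{X'\in\mathcal{F}}f(X')\;-\;\delta\bigl(1-e^{-\lfloor k/p\rfloor/k}\bigr)k.$$ In particular, if $\mathcal{L}$ is a modular lattice and $\delta=0$, the algorithm gives a $(1-1/e)$-approximation.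
   Context: A lattice $(\mathcal{L},\le)$ is a poset in which any two elements $X,Y$ have a least upper bound (join) $X\vee Y$ and greatest lower bound (meet) $X\wedge Y$; here it has a least element $\bot$. A lattice is modular if $X\le B$ implies $X\vee(A\wedge B)=(X\vee A)\wedge B$. A chain $X_1<\dots<X_k$ is a composition series if there is no $Y$ with $X_i<Y<X_{i+1}$ for any $i$; the height $h(X)$ of $X$ is the length of the longest composition series from $\bot$ to $X$. An element $a$ is join-irreducible if there are no $X\neq a$, $Y\neq a$ with $a=X\vee Y$; $J(\mathcal{L})$ is the set of join-irreducible elements. For $X\in\mathcal{L}$, $a\in J(\mathcal{L})$ is admissible with respect to $X$ if $a\not\le X$ and every $a'\in\mathcal{L}$ with $a'<a$ satisfies $a'\le X$; $\mathrm{adm}(X)$ denotes the set of such elements. For $b\in\mathrm{adm}(Y)$, the closure is $\mathrm{cl}(b\mid Y)=\{b'\in\mathrm{adm}(Y): Y\vee b=Y\vee b'\}$. A function $f\colon\mathcal{L}\to\mathbb{R}$ is monotone if $X\le Y$ implies $f(X)\le f(Y)$. It is downward DR-submodular with additive gap $\delta$ if for all $X\le Y$ in $\mathcal{L}$ and all $b\in\mathrm{adm}(Y)$, $$f(Y\vee b)-f(Y)\le \max_{b'\in\mathrm{cl}(b\mid Y)}\ \min_{a\in\mathrm{adm}(X),\,a\le b'}\bigl(f(X\vee a)-f(X)\bigr)+\delta.$$ A feasible $X$ is an $(\alpha,\delta')$-approximate solution if $f(X)\ge\alpha\max_{X'\in\mathcal{F}}f(X')-\delta'$.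
   Formalization: Chains from ⊥ to each X are assumed to have bounded length (finite height; with dense chains the claim can fail), and δ ≥ 0 is assumed (automatic unless the lattice has one element); greedy leaves X unchanged when no feasible admissible element remains. *)

theory Defs
  imports Complex_Main "HOL-Library.Extended_Real"
begin

unbundle lattice_syntax

definition chain_from_to :: "'a::order \<Rightarrow> 'a \<Rightarrow> 'a list \<Rightarrow> bool" where
  "chain_from_to A B xs \<longleftrightarrow> sorted_wrt (<) xs \<and> xs \<noteq> [] \<and> hd xs = A \<and> last xs = B"

definition composition_series :: "'a::order list \<Rightarrow> bool" where
  "composition_series xs \<longleftrightarrow> sorted_wrt (<) xs \<and>
     (\<forall>i. Suc i < length xs \<longrightarrow> \<not> (\<exists>Y. xs ! i < Y \<and> Y < xs ! Suc i))"

text \<open>Without this the length of a longest composition series below \<open>X\<close> is not a meaningful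
  height: there may be no composition series at all, or all of them may be short although
  \<open>[\<bottom>, X]\<close> contains infinite (e.g. dense) chains.\<close>

definition finite_height :: "'a::bounded_lattice_bot \<Rightarrow> bool" where
  "finite_height X \<longleftrightarrow> (\<exists>n. \<forall>xs. chain_from_to \<bottom> X xs \<longrightarrow> length xs \<le> n)"

text \<open>The length of a series is its number of steps, so that \<open>\<bottom>\<close> has height \<open>0\<close>. The set is finite
  and nonempty when \<open>X\<close> has finite height.\<close>

definition height :: "'a::bounded_lattice_bot \<Rightarrow> nat" where
  "height X = Max {length xs - 1 | xs. composition_series xs \<and> chain_from_to \<bottom> X xs}"

definition join_irreducible :: "'a::lattice \<Rightarrow> bool" where
  "join_irreducible a \<longleftrightarrow> \<not> (\<exists>X Y. X \<noteq> a \<and> Y \<noteq> a \<and> a = X \<squnion> Y)"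

definition adm :: "'a::lattice \<Rightarrow> 'a set" where
  "adm X = {a. join_irreducible a \<and> \<not> a \<le> X \<and> (\<forall>a'. a' < a \<longrightarrow> a' \<le> X)}"

definition cl :: "'a::lattice \<Rightarrow> 'a \<Rightarrow> 'a set" where
  "cl b Y = {b' \<in> adm Y. Y \<squnion> b = Y \<squnion> b'}"

text \<open>The sets may be infinite, so max and min are read as supremum and infimum in the extended
  reals; this agrees with max and min whenever these are attained. If \<open>f\<close> is monotone and all
  elements have finite height, both sets are nonempty and both bounds are finite.\<close>

definition downward_DR_submodular :: "('a::lattice \<Rightarrow> real) \<Rightarrow> real \<Rightarrow> bool" where
  "downward_DR_submodular f \<delta> \<longleftrightarrow>
     (\<forall>X Y. X \<le> Y \<longrightarrow> (\<forall>b \<in> adm Y.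
        ereal (f (Y \<squnion> b) - f Y) \<le>
          (SUP b' \<in> cl b Y. INF a \<in> {a \<in> adm X. a \<le> b'}. ereal (f (X \<squnion> a) - f X)) + ereal \<delta>))"

definition modular_lattice :: "'a::lattice itself \<Rightarrow> bool" where
  "modular_lattice _ \<longleftrightarrow> (\<forall>X A B :: 'a. X \<le> B \<longrightarrow> X \<squnion> (A \<sqinter> B) = (X \<squnion> A) \<sqinter> B)"

definition incremental_height :: "'a::bounded_lattice_bot itself \<Rightarrow> nat \<Rightarrow> bool" where
  "incremental_height _ p \<longleftrightarrow>
     (\<forall>X :: 'a. \<forall>a \<in> adm X. int (height (X \<squnion> a)) - int (height X) \<le> int p)"

definition greedy_candidates :: "'a::lattice set \<Rightarrow> 'a \<Rightarrow> 'a set" where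
  "greedy_candidates F X = {a \<in> adm X. X \<squnion> a \<in> F}"

text \<open>The algorithm stays at \<open>X\<close> when no admissible element can be added feasibly (this does happen
  before the last round when a step may raise the height by more than one). If there are
  candidates but the maximum is not attained, there is no successor.\<close>

definition greedy_step :: "('a::lattice \<Rightarrow> real) \<Rightarrow> 'a set \<Rightarrow> 'a \<Rightarrow> 'a \<Rightarrow> bool" where
  "greedy_step f F X X' \<longleftrightarrow>
     (if greedy_candidates F X = {} then X' = X
      else \<exists>a. is_arg_max (\<lambda>a. f (X \<squnion> a)) (\<lambda>a. a \<in> greedy_candidates F X) a \<and> X' = X \<squnion> a)"

definition greedy_output :: "('a::bounded_lattice_bot \<Rightarrow> real) \<Rightarrow> 'a set \<Rightarrow> nat \<Rightarrow> 'a \<Rightarrow> bool" where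
  "greedy_output f F k X \<longleftrightarrow> (greedy_step f F ^^ k) \<bottom> X"

text \<open>As above, the maximum is the supremum in the extended reals.\<close>

definition approximate_solution :: "('a \<Rightarrow> real) \<Rightarrow> 'a set \<Rightarrow> real \<Rightarrow> real \<Rightarrow> 'a \<Rightarrow> bool" where
  "approximate_solution f F \<alpha> \<delta>' X \<longleftrightarrow>
     X \<in> F \<and> ereal (f X) \<ge> ereal \<alpha> * (SUP X' \<in> F. ereal (f X')) - ereal \<delta>'"

end

theory Submission
  imports Defs
begin

text \<open>
  Let \<open>S\<close> have height at most \<open>k\<close> and let \<open>X\<close> be the current greedy iterate. A maximal chain from
  \<open>\<bottom>\<close> to \<open>S\<close> has at most \<open>k\<close> steps, each of which joins an element admissible for its lower end;
  joining the whole chain with \<open>X\<close> leads from \<open>X\<close> to \<open>X \<squnion> S\<close> in at most \<open>k\<close> admissible steps.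
  As long as \<open>height X + p \<le> k\<close>, every element of \<open>adm X\<close> is a greedy candidate, so by downward
  DR-submodularity each of these steps gains at most the greedy gain plus \<open>\<delta>\<close>. Hence one greedy
  step multiplies the deficit \<open>f S - k \<delta> - f X\<close> by at most \<open>1 - 1/k\<close>, and this applies to the first
  \<open>\<lfloor>k/p\<rfloor>\<close> steps. In a modular lattice the height is submodular, and \<open>height a \<le> height (X \<sqinter> a) + 1\<close>
  for admissible \<open>a\<close>, so \<open>p = 1\<close>.
\<close>

section \<open>Height\<close>

lemma chain_from_to_same_iff: "chain_from_to A A xs \<longleftrightarrow> xs = [A]"
  by (cases xs) (auto simp: chain_from_to_def split: if_splits dest!: last_in_set)

lemma chain_from_to_snoc:
  assumes "chain_from_to A B xs" and "B < C"
  shows "chain_from_to A C (xs @ [C])"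
proof -
  have "x \<le> B" if "x \<in> set xs" for x
    using assms(1) that by (cases xs rule: rev_cases)
      (auto simp: chain_from_to_def sorted_wrt_append less_imp_le)
  then show ?thesis
    using assms by (auto simp: chain_from_to_def sorted_wrt_append intro: le_less_trans)
qed

lemma chain_from_to_insert:
  assumes "chain_from_to A B (us @ x # y # vs)" and "x < z" and "z < y"
  shows "chain_from_to A B (us @ x # z # y # vs)"
  using assms
  by (auto simp: chain_from_to_def sorted_wrt_append hd_append dest: less_trans)

lemma composition_series_if_longest:
  assumes chain: "chain_from_to A B xs"
    and longest: "\<And>ys. chain_from_to A B ys \<Longrightarrow> length ys \<le> length xs"
  shows "composition_series xs"
proof (rule ccontr)
  assume "\<not> composition_series xs"
  then obtain i z where i: "Suc i < length xs" and z: "xs ! i < z" "z < xs ! Suc i"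
    using chain by (auto simp: composition_series_def chain_from_to_def)
  have xs_split: "xs = take i xs @ xs ! i # xs ! Suc i # drop (Suc (Suc i)) xs"
    using i by (simp add: Cons_nth_drop_Suc)
  let ?ys = "take i xs @ xs ! i # z # xs ! Suc i # drop (Suc (Suc i)) xs"
  have "chain_from_to A B ?ys"
    using chain z by (intro chain_from_to_insert) (simp_all flip: xs_split)
  from longest[OF this] i show False by simp
qed

lemma obtain_longest_chain:
  assumes "finite_height Z"
  obtains xs where "chain_from_to \<bottom> Z xs" and "length xs = Suc (height Z)"
    and "\<And>ys. chain_from_to \<bottom> Z ys \<Longrightarrow> length ys \<le> Suc (height Z)"
proof -
  obtain n where n: "\<And>xs. chain_from_to \<bottom> Z xs \<Longrightarrow> length xs \<le> n"
    using assms by (auto simp: finite_height_def)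
  have "chain_from_to \<bottom> Z (if Z = \<bottom> then [\<bottom>] else [\<bottom>, Z])"
    by (simp add: chain_from_to_def order_less_le)
  then have "\<exists>xs. chain_from_to \<bottom> Z xs \<and> (\<forall>ys. chain_from_to \<bottom> Z ys \<longrightarrow> length ys \<le> length xs)"
    by (rule ex_has_greatest_nat[where b = "Suc n"]) (simp add: n less_Suc_eq_le)
  then obtain xs where xs: "chain_from_to \<bottom> Z xs"
    and longest: "\<And>ys. chain_from_to \<bottom> Z ys \<Longrightarrow> length ys \<le> length xs"
    by blast
  have "height Z = length xs - 1"
    unfolding height_def
  proof (intro Max_eqI)
    have "{length ys - 1 | ys. composition_series ys \<and> chain_from_to \<bottom> Z ys} \<subseteq> {..length xs - 1}"
      by (auto intro: diff_le_mono longest)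
    then show "finite {length ys - 1 | ys. composition_series ys \<and> chain_from_to \<bottom> Z ys}"
      by (rule finite_subset) simp
    show "length xs - 1 \<in> {length ys - 1 | ys. composition_series ys \<and> chain_from_to \<bottom> Z ys}"
      using composition_series_if_longest[OF xs longest] xs by blast
  qed (auto intro: diff_le_mono longest)
  moreover have "xs \<noteq> []" using xs by (simp add: chain_from_to_def)
  ultimately have "length xs = Suc (height Z)" by (cases xs) auto
  with xs longest show ?thesis by (intro that) auto
qed

lemma length_chain_le_Suc_height:
  assumes "finite_height Z" and "chain_from_to \<bottom> Z xs"
  shows "length xs \<le> Suc (height Z)"
  using obtain_longest_chain[OF assms(1)] assms(2) by metis

lemma height_bot [simp]: "height \<bottom> = 0"
  by (simp add: height_def composition_series_def chain_from_to_same_iff)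

lemma finite_height_downward:
  assumes "finite_height Z" and "Y \<le> Z"
  shows "finite_height Y"
proof (cases "Y = Z")
  case False
  then have "Y < Z" using \<open>Y \<le> Z\<close> by simp
  obtain n where n: "\<And>xs. chain_from_to \<bottom> Z xs \<Longrightarrow> length xs \<le> n"
    using \<open>finite_height Z\<close> by (auto simp: finite_height_def)
  have "length xs \<le> n" if "chain_from_to \<bottom> Y xs" for xs
    using n[OF chain_from_to_snoc[OF that \<open>Y < Z\<close>]] by simp
  then show ?thesis by (auto simp: finite_height_def)
qed (use assms in simp)

lemma height_strict_mono:
  assumes "finite_height Z" and "Y < Z"
  shows "height Y < height Z"
proof -
  have "finite_height Y" using assms by (auto intro: finite_height_downward)
  then obtain xs where xs: "chain_from_to \<bottom> Y xs" "length xs = Suc (height Y)"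
    by (rule obtain_longest_chain)
  have "length (xs @ [Z]) \<le> Suc (height Z)"
    using assms xs(1) by (intro length_chain_le_Suc_height chain_from_to_snoc)
  then show ?thesis using xs(2) by simp
qed

lemma height_mono:
  assumes "finite_height Z" and "Y \<le> Z"
  shows "height Y \<le> height Z"
  using assms height_strict_mono[of Z Y] by (cases "Y = Z") (auto simp: order_less_le)

lemma obtain_height_predecessor:
  assumes "finite_height Z" and "Z \<noteq> \<bottom>"
  obtains Y where "Y < Z" and "height Z = Suc (height Y)"
proof -
  obtain xs where xs: "chain_from_to \<bottom> Z xs" "length xs = Suc (height Z)"
    using assms(1) by (rule obtain_longest_chain)
  obtain ys where ys: "xs = ys @ [Z]"
    using xs(1) by (cases xs rule: rev_cases) (auto simp: chain_from_to_def)
  have "ys \<noteq> []" using xs(1) assms(2) ys by (auto simp: chain_from_to_def)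
  then have chain: "chain_from_to \<bottom> (last ys) ys" and less: "last ys < Z"
    using xs(1) ys by (auto simp: chain_from_to_def sorted_wrt_append)
  have "finite_height (last ys)"
    using assms(1) less by (auto intro: finite_height_downward)
  then have "height Z \<le> Suc (height (last ys))"
    using length_chain_le_Suc_height[OF _ chain] xs(2) ys by simp
  with height_strict_mono[OF assms(1) less] have "height Z = Suc (height (last ys))" by simp
  with less show ?thesis by (rule that)
qed

section \<open>Admissible elements\<close>

lemma less_sup_adm: "a \<in> adm X \<Longrightarrow> X < X \<squnion> a"
  by (simp add: adm_def less_le_not_le)

lemma adm_upward: "a \<in> adm X \<Longrightarrow> X \<le> Y \<Longrightarrow> \<not> a \<le> Y \<Longrightarrow> a \<in> adm Y"
  by (auto simp: adm_def intro: order_trans)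

lemma obtain_adm_below:
  assumes "finite_height b" and "\<not> b \<le> X"
  obtains a where "a \<in> adm X" and "a \<le> b"
proof -
  obtain a where a: "a \<le> b" "\<not> a \<le> X"
    and least: "\<And>c. c \<le> b \<Longrightarrow> \<not> c \<le> X \<Longrightarrow> height a \<le> height c"
    using ex_has_least_nat[of "\<lambda>a. a \<le> b \<and> \<not> a \<le> X" b height] assms(2) by auto
  have "finite_height a" using assms(1) a(1) by (rule finite_height_downward)
  then have below: "c \<le> X" if "c < a" for c
    using least[of c] height_strict_mono[OF _ that] that a(1) by force
  have "join_irreducible a"
    unfolding join_irreducible_def
  proof (rule notI, elim exE conjE)
    fix Y Z assume "Y \<noteq> a" "Z \<noteq> a" and eq: "a = Y \<squnion> Z"
    then have "Y < a" "Z < a" unfolding order_less_le by auto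
    then have "Y \<squnion> Z \<le> X" using below by simp
    with a(2) eq show False by simp
  qed
  with a below show ?thesis by (intro that) (auto simp: adm_def)
qed

lemma obtain_adm_sup_eq:
  assumes "finite_height Z" and "Z \<noteq> \<bottom>"
  obtains Y a where "a \<in> adm Y" and "Y \<squnion> a = Z" and "height Z = Suc (height Y)"
proof -
  obtain Y where Y: "Y < Z" "height Z = Suc (height Y)"
    using assms by (rule obtain_height_predecessor)
  then obtain a where a: "a \<in> adm Y" "a \<le> Z"
    using obtain_adm_below[OF assms(1), of Y] by (auto simp: less_le_not_le)
  have "Y \<squnion> a = Z"
  proof (rule ccontr)
    assume "Y \<squnion> a \<noteq> Z"
    then have "Y \<squnion> a < Z" using Y(1) a(2) by (simp add: order_less_le)
    with assms(1) have "height (Y \<squnion> a) < height Z" and "finite_height (Y \<squnion> a)"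
      by (rule height_strict_mono, intro finite_height_downward[OF assms(1)] less_imp_le)
    with height_strict_mono[OF _ less_sup_adm[OF a(1)]] Y(2) show False by simp
  qed
  with a(1) Y(2) show ?thesis by (intro that)
qed

lemma adm_induct [consumes 1, case_names bot sup]:
  assumes "finite_height Z"
    and bot: "P \<bottom>"
    and sup: "\<And>Y a. Y \<squnion> a \<le> Z \<Longrightarrow> a \<in> adm Y \<Longrightarrow> height (Y \<squnion> a) = Suc (height Y) \<Longrightarrow> P Y \<Longrightarrow>
      P (Y \<squnion> a)"
  shows "P Z"
proof -
  have "P W" if "W \<le> Z" for W
    using that
  proof (induction "height W" arbitrary: W rule: less_induct)
    case less
    show ?case
    proof (cases "W = \<bottom>")
      case False
      have "finite_height W" using assms(1) less.prems by (rule finite_height_downward)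
      then obtain Y a where "a \<in> adm Y" and W: "Y \<squnion> a = W" and "height W = Suc (height Y)"
        using False by (rule obtain_adm_sup_eq)
      moreover from this less.prems have "P Y" by (intro less.hyps) auto
      ultimately show ?thesis using sup[of Y a] less.prems by simp
    qed (simp add: bot)
  qed
  then show ?thesis by simp
qed

lemma height_adm_le:
  assumes "finite_height a" and "a \<in> adm X"
  shows "height a \<le> Suc (height (X \<sqinter> a))"
proof -
  have "a \<noteq> \<bottom>" using assms(2) by (auto simp: adm_def)
  with assms(1) obtain Y where Y: "Y < a" "height a = Suc (height Y)"
    by (rule obtain_height_predecessor)
  have "Y \<le> X \<sqinter> a" using assms(2) Y(1) by (simp add: adm_def)
  moreover have "finite_height (X \<sqinter> a)"
    using assms(1) by (rule finite_height_downward) simp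
  ultimately show ?thesis using Y(2) by (simp add: height_mono)
qed

section \<open>Modular lattices\<close>

lemma modular_latticeD:
  fixes X A B :: "'a::lattice"
  assumes "modular_lattice TYPE('a)" and "X \<le> B"
  shows "X \<squnion> (A \<sqinter> B) = (X \<squnion> A) \<sqinter> B"
  using assms by (simp add: modular_lattice_def)

lemma modular_lattice_cancel:
  fixes X Y Z :: "'a::lattice"
  assumes "modular_lattice TYPE('a)" and "Y \<le> Z"
    and "Z \<sqinter> X \<le> Y" and "Z \<le> Y \<squnion> X"
  shows "Y = Z"
proof -
  have "Y = Y \<squnion> (X \<sqinter> Z)" using assms(3) by (simp add: sup_absorb1 inf_commute)
  also have "\<dots> = (Y \<squnion> X) \<sqinter> Z" using assms(1,2) by (rule modular_latticeD)
  also have "\<dots> = Z" using assms(4) by (simp add: inf_absorb2)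
  finally show ?thesis .
qed

lemma modular_inf_less_or_sup_inf_less:
  fixes X Y V W :: "'a::lattice"
  assumes modular: "modular_lattice TYPE('a)" and "V < W" and "W \<le> X \<squnion> Y"
  shows "V \<sqinter> X < W \<sqinter> X \<or> (V \<squnion> X) \<sqinter> Y < (W \<squnion> X) \<sqinter> Y"
proof (rule ccontr)
  assume not_less: "\<not> ?thesis"
  have "V \<sqinter> X \<le> W \<sqinter> X" and "(V \<squnion> X) \<sqinter> Y \<le> (W \<squnion> X) \<sqinter> Y"
    using \<open>V < W\<close> by (meson inf_mono less_imp_le order_refl sup_mono)+
  with not_less have meet_eq: "V \<sqinter> X = W \<sqinter> X" and join_eq: "(V \<squnion> X) \<sqinter> Y = (W \<squnion> X) \<sqinter> Y"
    by (auto simp: order_less_le)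
  have "W \<le> (X \<squnion> Y) \<sqinter> (W \<squnion> X)" using \<open>W \<le> X \<squnion> Y\<close> by simp
  also have "\<dots> = X \<squnion> (Y \<sqinter> (W \<squnion> X))" using modular by (rule modular_latticeD[symmetric]) simp
  also have "\<dots> = X \<squnion> ((V \<squnion> X) \<sqinter> Y)" using join_eq by (simp add: inf_commute)
  also have "\<dots> \<le> V \<squnion> X" by simp
  finally have "W \<le> V \<squnion> X" .
  moreover have "W \<sqinter> X \<le> V" using meet_eq[symmetric] by simp
  ultimately have "V = W" using modular \<open>V < W\<close> by (intro modular_lattice_cancel) simp_all
  with \<open>V < W\<close> show False by simp
qed

lemma modular_height_submodular:
  fixes X Y :: "'a::bounded_lattice_bot"
  assumes modular: "modular_lattice TYPE('a)" and finite: "finite_height (X \<squnion> Y)"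
  shows "height (X \<squnion> Y) + height (X \<sqinter> Y) \<le> height X + height Y"
proof -
  \<comment> \<open>In this form \<open>X \<squnion> Y\<close> can be replaced by any element \<open>V\<close> below it: the left-hand side is then
    \<open>height V + height (X \<sqinter> Y)\<close>, and each step up from \<open>V\<close> raises one of the terms on the right.\<close>
  have "height (X \<squnion> Y) + height (X \<sqinter> Y)
      \<le> height ((X \<squnion> Y) \<sqinter> X) + height (((X \<squnion> Y) \<squnion> X) \<sqinter> Y)"
    using finite
  proof (induction rule: adm_induct)
    case bot
    show ?case by simp
  next
    case (sup V a)
    let ?W = "V \<squnion> a"
    have "V \<sqinter> X < ?W \<sqinter> X \<or> (V \<squnion> X) \<sqinter> Y < (?W \<squnion> X) \<sqinter> Y"
      using modular less_sup_adm[OF sup.hyps(2)] sup.hyps(1)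
      by (rule modular_inf_less_or_sup_inf_less)
    moreover have "V \<sqinter> X \<le> ?W \<sqinter> X" and "(V \<squnion> X) \<sqinter> Y \<le> (?W \<squnion> X) \<sqinter> Y"
      by (intro inf_mono sup_mono sup_ge1 order_refl)+
    moreover have "finite_height (?W \<sqinter> X)" and "finite_height ((?W \<squnion> X) \<sqinter> Y)"
      by (rule finite_height_downward[OF finite], simp add: le_infI2)+
    ultimately have "height (V \<sqinter> X) + height ((V \<squnion> X) \<sqinter> Y)
        < height (?W \<sqinter> X) + height ((?W \<squnion> X) \<sqinter> Y)"
      by (metis add_less_le_mono add_le_less_mono height_strict_mono height_mono)
    with sup.IH sup.hyps(3) show ?case by simp
  qed
  then show ?thesis by (simp add: inf_absorb2 sup_absorb1)
qed

lemma modular_incremental_height: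
  assumes "modular_lattice TYPE('a::bounded_lattice_bot)" and "\<And>Z :: 'a. finite_height Z"
  shows "incremental_height TYPE('a) 1"
  unfolding incremental_height_def
proof (intro allI ballI)
  fix X a :: 'a
  assume "a \<in> adm X"
  then have "height a \<le> Suc (height (X \<sqinter> a))" by (intro height_adm_le assms(2))
  with modular_height_submodular[OF assms, of X a]
  show "int (height (X \<squnion> a)) - int (height X) \<le> int 1" by simp
qed

section \<open>Downward DR-submodular functions\<close>

lemma downward_DR_submodular_adm_gain_le:
  fixes f :: "'a::bounded_lattice_bot \<Rightarrow> real"
  assumes "\<And>Z :: 'a. finite_height Z" and "downward_DR_submodular f \<delta>"
    and "X \<le> Y" and "b \<in> adm Y"
    and gain: "\<And>a. a \<in> adm X \<Longrightarrow> f (X \<squnion> a) - f X \<le> g"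
  shows "f (Y \<squnion> b) - f Y \<le> g + \<delta>"
proof -
  have "(SUP b' \<in> cl b Y. INF a \<in> {a \<in> adm X. a \<le> b'}. ereal (f (X \<squnion> a) - f X)) \<le> ereal g"
    (is "?max_min_gain \<le> _")
  proof (rule SUP_least)
    fix b' assume "b' \<in> cl b Y"
    then have "\<not> b' \<le> X" using \<open>X \<le> Y\<close> by (auto simp: cl_def adm_def dest: order_trans)
    then obtain a where "a \<in> adm X" "a \<le> b'" by (rule obtain_adm_below[OF assms(1)])
    then show "(INF a \<in> {a \<in> adm X. a \<le> b'}. ereal (f (X \<squnion> a) - f X)) \<le> ereal g"
      using gain by (intro INF_lower2[of a]) auto
  qed
  have "ereal (f (Y \<squnion> b) - f Y) \<le> ?max_min_gain + ereal \<delta>"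
    using assms(2-4) unfolding downward_DR_submodular_def by blast
  also have "\<dots> \<le> ereal g + ereal \<delta>"
    using \<open>?max_min_gain \<le> ereal g\<close> by (rule add_right_mono)
  finally show ?thesis by simp
qed

lemma downward_DR_submodular_sup_le:
  fixes f :: "'a::bounded_lattice_bot \<Rightarrow> real"
  assumes finite: "\<And>Z :: 'a. finite_height Z" and DR: "downward_DR_submodular f \<delta>"
    and "0 \<le> g + \<delta>"
    and gain: "\<And>a. a \<in> adm X \<Longrightarrow> f (X \<squnion> a) - f X \<le> g"
  shows "f (X \<squnion> Z) \<le> f X + real (height Z) * (g + \<delta>)"
  using finite[of Z]
proof (induction rule: adm_induct)
  case bot
  show ?case by simp
next
  case (sup Y b)
  have "f ((X \<squnion> Y) \<squnion> b) - f (X \<squnion> Y) \<le> g + \<delta>"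
  proof (cases "b \<le> X \<squnion> Y")
    case True
    then show ?thesis using \<open>0 \<le> g + \<delta>\<close> by (simp add: sup_absorb1)
  next
    case False
    then have "b \<in> adm (X \<squnion> Y)" using sup.hyps(2) by (auto intro: adm_upward)
    then show ?thesis
      by (intro downward_DR_submodular_adm_gain_le[OF finite DR _ _ gain]) auto
  qed
  with sup.IH sup.hyps(3) show ?case by (simp add: sup_assoc algebra_simps)
qed

section \<open>The greedy algorithm\<close>

lemma greedy_stepE:
  assumes "greedy_step f F X X'"
  obtains (stay) "greedy_candidates F X = {}" "X' = X"
  | (join) a where "a \<in> adm X" "X \<squnion> a \<in> F" "X' = X \<squnion> a"
      "\<And>b. b \<in> greedy_candidates F X \<Longrightarrow> f (X \<squnion> b) \<le> f X'"
  using assms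
  by (auto simp: greedy_step_def is_arg_max_linorder greedy_candidates_def split: if_splits)

lemma greedy_step_le: "greedy_step f F X X' \<Longrightarrow> X \<le> X'"
  by (erule greedy_stepE) auto

lemma greedy_steps_le: "(greedy_step f F ^^ n) X X' \<Longrightarrow> X \<le> X'"
  by (induction n arbitrary: X') (auto dest: greedy_step_le intro: order_trans)

lemma greedy_steps_mem: "(greedy_step f F ^^ n) X X' \<Longrightarrow> X \<in> F \<Longrightarrow> X' \<in> F"
  by (induction n arbitrary: X') (auto elim: greedy_stepE)

lemma height_sup_adm_le:
  fixes X :: "'a::bounded_lattice_bot"
  assumes "incremental_height TYPE('a) p" and "a \<in> adm X"
  shows "height (X \<squnion> a) \<le> height X + p"
  using assms by (force simp: incremental_height_def)

lemma height_greedy_steps_le: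
  fixes X :: "'a::bounded_lattice_bot"
  assumes "incremental_height TYPE('a) p"
  shows "(greedy_step f F ^^ n) X X' \<Longrightarrow> height X' \<le> height X + n * p"
proof (induction n arbitrary: X')
  case (Suc n)
  then obtain Y where Y: "height Y \<le> height X + n * p" and "greedy_step f F Y X'" by auto
  from this(2) have "height X' \<le> height Y + p"
    by (cases rule: greedy_stepE) (auto intro: height_sup_adm_le[OF assms])
  with Y show ?case by simp
qed simp

lemma one_minus_power_le_exp:
  fixes x :: real
  assumes "x \<le> 1"
  shows "(1 - x) ^ n \<le> exp (- (real n * x))"
proof -
  have "(1 - x) ^ n \<le> exp (- x) ^ n"
    using assms exp_ge_add_one_self[of "- x"] by (intro power_mono) auto
  then show ?thesis by (simp add: exp_of_nat_mult[symmetric])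
qed

lemma approximate_solutionI:
  assumes "X \<in> F" and "0 \<le> \<alpha>" and "\<And>S. S \<in> F \<Longrightarrow> \<alpha> * f S - \<delta>' \<le> f X"
  shows "approximate_solution f F \<alpha> \<delta>' X"
proof -
  have "ereal \<alpha> * (SUP S \<in> F. ereal (f S)) = (SUP S \<in> F. ereal \<alpha> * ereal (f S))"
    using assms(1,2) by (intro Sup_ereal_mult_left') auto
  also have "\<dots> \<le> ereal (f X + \<delta>')"
    using assms(3) by (intro SUP_least) (force simp: algebra_simps)
  finally show ?thesis
    using assms(1) by (simp add: approximate_solution_def ereal_minus_le_iff add.commute)
qed

locale monotone_DR_submodular =
  fixes f :: "'a::bounded_lattice_bot \<Rightarrow> real" and \<delta> :: real
  assumes finite_height: "\<And>Z :: 'a. finite_height Z"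
    and mono: "mono f"
    and gap_nonneg: "0 \<le> \<delta>"
    and DR_submodular: "downward_DR_submodular f \<delta>"
begin

definition deficit :: "nat \<Rightarrow> 'a \<Rightarrow> 'a \<Rightarrow> real" where
  "deficit k S X = f S - real k * \<delta> - f X"

lemma greedy_step_gain_nonneg: "greedy_step f F X X' \<Longrightarrow> 0 \<le> f X' - f X + \<delta>"
  using monoD[OF mono greedy_step_le[of f F X X']] gap_nonneg by simp

lemma le_greedy_step_gain:
  assumes step: "greedy_step f F X X'" and feasible: "\<And>a. a \<in> adm X \<Longrightarrow> X \<squnion> a \<in> F"
  shows "f S \<le> f X + real (height S) * (f X' - f X + \<delta>)"
proof -
  have candidates: "greedy_candidates F X = adm X"
    using feasible by (auto simp: greedy_candidates_def)
  from step have gain: "f (X \<squnion> a) - f X \<le> f X' - f X" if "a \<in> adm X" for a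
    using that by (cases rule: greedy_stepE) (auto simp: candidates)
  from downward_DR_submodular_sup_le[OF finite_height DR_submodular
      greedy_step_gain_nonneg[OF step] gain]
  have "f (X \<squnion> S) \<le> f X + real (height S) * (f X' - f X + \<delta>)" .
  moreover have "f S \<le> f (X \<squnion> S)" using mono by (simp add: monoD)
  ultimately show ?thesis by simp
qed

lemma deficit_greedy_step_le:
  assumes step: "greedy_step f F X X'" and feasible: "\<And>a. a \<in> adm X \<Longrightarrow> X \<squnion> a \<in> F"
    and "height S \<le> k" and "0 < k"
  shows "deficit k S X' \<le> (1 - 1 / k) * deficit k S X"
proof -
  have "f S \<le> f X + real (height S) * (f X' - f X + \<delta>)"
    using step feasible by (rule le_greedy_step_gain)
  also have "\<dots> \<le> f X + real k * (f X' - f X + \<delta>)"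
    using greedy_step_gain_nonneg[OF step] \<open>height S \<le> k\<close>
    by (intro add_left_mono mult_right_mono) auto
  finally show ?thesis using \<open>0 < k\<close> by (simp add: deficit_def field_simps)
qed

lemma deficit_greedy_steps_le:
  assumes incremental: "incremental_height TYPE('a) p" and "height S \<le> k" and "0 < k"
  shows "(greedy_step f {Z. height Z \<le> m} ^^ n) X X' \<Longrightarrow> height X + n * p \<le> m \<Longrightarrow>
    deficit k S X' \<le> (1 - 1 / k) ^ n * deficit k S X"
proof (induction n arbitrary: X')
  case (Suc n)
  then obtain Y where steps: "(greedy_step f {Z. height Z \<le> m} ^^ n) X Y"
    and step: "greedy_step f {Z. height Z \<le> m} Y X'" by auto
  have "height (Y \<squnion> a) \<le> m" if "a \<in> adm Y" for a
    using height_sup_adm_le[OF incremental that] height_greedy_steps_le[OF incremental steps]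
      Suc.prems(2) by simp
  then have "deficit k S X' \<le> (1 - 1 / k) * deficit k S Y"
    using assms(2,3) by (intro deficit_greedy_step_le[OF step]) auto
  also have "\<dots> \<le> (1 - 1 / k) * ((1 - 1 / k) ^ n * deficit k S X)"
    using Suc.IH[OF steps] Suc.prems(2) \<open>0 < k\<close> by (intro mult_left_mono) auto
  finally show ?case by (simp add: mult.assoc)
qed simp

lemma greedy_output_ge:
  assumes incremental: "incremental_height TYPE('a) p" and "0 < k" and "0 \<le> f \<bottom>"
    and greedy: "greedy_output f {Z. height Z \<le> k} k X" and "height S \<le> k"
  shows "(1 - exp (- (real (k div p) / k))) * (f S - k * \<delta>) \<le> f X"
proof (cases "0 \<le> f S - k * \<delta>")
  case True
  let ?q = "k div p"
  have "?q + (k - ?q) = k" by simp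
  then obtain Y where early_steps: "(greedy_step f {Z. height Z \<le> k} ^^ ?q) \<bottom> Y"
    and later_steps: "(greedy_step f {Z. height Z \<le> k} ^^ (k - ?q)) Y X"
    using greedy unfolding greedy_output_def by (metis relpowp_add relcomppE)
  have "f S - k * \<delta> - f Y \<le> (1 - 1 / k) ^ ?q * (f S - k * \<delta> - f \<bottom>)"
    using deficit_greedy_steps_le[OF incremental \<open>height S \<le> k\<close> \<open>0 < k\<close> early_steps]
    by (simp add: deficit_def)
  also have "\<dots> \<le> (1 - 1 / k) ^ ?q * (f S - k * \<delta>)"
    using \<open>0 < k\<close> \<open>0 \<le> f \<bottom>\<close> by (intro mult_left_mono) auto
  also have "\<dots> \<le> exp (- (real ?q / k)) * (f S - k * \<delta>)"
    using one_minus_power_le_exp[of "1 / k" ?q] \<open>0 < k\<close> True by (intro mult_right_mono) auto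
  finally have "(1 - exp (- (real ?q / k))) * (f S - k * \<delta>) \<le> f Y"
    by (simp add: algebra_simps)
  also have "\<dots> \<le> f X" using mono greedy_steps_le[OF later_steps] by (rule monoD)
  finally show ?thesis .
next
  case False
  then have "(1 - exp (- (real (k div p) / k))) * (f S - k * \<delta>) \<le> 0"
    by (intro mult_nonneg_nonpos) auto
  also have "0 \<le> f X" using monoD[OF mono, of \<bottom> X] \<open>0 \<le> f \<bottom>\<close> by simp
  finally show ?thesis .
qed

lemma greedy_output_approximate_solution:
  assumes "incremental_height TYPE('a) p" and "0 < k" and "0 \<le> f \<bottom>"
    and "greedy_output f {Z. height Z \<le> k} k X"
  shows "approximate_solution f {Z. height Z \<le> k} (1 - exp (- (real (k div p) / k)))
    (\<delta> * (1 - exp (- (real (k div p) / k))) * k) X"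
proof (rule approximate_solutionI)
  show "X \<in> {Z. height Z \<le> k}"
    using assms(4) unfolding greedy_output_def by (rule greedy_steps_mem) simp
  show "0 \<le> 1 - exp (- (real (k div p) / k))" by simp
  show "(1 - exp (- (real (k div p) / k))) * f S
      - \<delta> * (1 - exp (- (real (k div p) / k))) * k \<le> f X" if "S \<in> {Z. height Z \<le> k}" for S
    using greedy_output_ge[OF assms, of S] that by (simp add: algebra_simps)
qed

end

theorem theorem1:
  fixes f :: "'a::bounded_lattice_bot \<Rightarrow> real" and \<delta> :: real and k p :: nat
    and F :: "'a set" and X :: 'a
  assumes "\<forall>Z :: 'a. finite_height Z"
    and "k > 0"
    and "F = {Z. height Z \<le> k}"
    and "mono f" and "f \<bottom> = 0"
    and "\<delta> \<ge> 0" and "downward_DR_submodular f \<delta>"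
    and "greedy_output f F k X"
  shows "(p > 0 \<and> incremental_height TYPE('a) p \<longrightarrow>
            approximate_solution f F
              (1 - exp (- (real_of_int \<lfloor>real k / real p\<rfloor> / real k)))
              (\<delta> * (1 - exp (- (real_of_int \<lfloor>real k / real p\<rfloor> / real k))) * real k) X)
       \<and> (modular_lattice TYPE('a) \<and> \<delta> = 0 \<longrightarrow>
            approximate_solution f F (1 - 1 / exp 1) 0 X)"
proof -
  interpret monotone_DR_submodular f \<delta>
    using assms by unfold_locales auto
  note greedy_approximation =
    greedy_output_approximate_solution[OF _ assms(2) _ assms(8)[unfolded assms(3)], folded assms(3)]
  have "real_of_int \<lfloor>real k / real p\<rfloor> = real (k div p)"
    by (simp add: floor_divide_of_nat_eq)
  then have "approximate_solution f F
      (1 - exp (- (real_of_int \<lfloor>real k / real p\<rfloor> / real k)))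
      (\<delta> * (1 - exp (- (real_of_int \<lfloor>real k / real p\<rfloor> / real k))) * real k) X"
    if "incremental_height TYPE('a) p"
    using greedy_approximation[OF that] assms(5) by simp
  moreover have "approximate_solution f F (1 - 1 / exp 1) 0 X"
    if "modular_lattice TYPE('a)" and "\<delta> = 0"
    using greedy_approximation[OF modular_incremental_height[OF that(1) finite_height]]
      that(2) assms(2,5) by (simp add: exp_minus inverse_eq_divide)
  ultimately show ?thesis by blast
qed

end
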